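(* Let $b>1$, $2<p<\infty$, $2<q<\infty$. There is a constant $C(p,q,b)>0$, depending only on $p,q,b$, with the following property. Let $N\in\mathbb N$ and let $\Lambda_N=\{k_i\}_{i=1}^N$ be a lacunary sequence of positive integers: $k_{i+1}\ge bk_i$, $i=1,\dots,N-1$. Denote $$\mathcal T(\Lambda_N):=\left\{f:\ f(x)=\sum_{k\in\Lambda_N}c_ke^{ikx},\ x\in\mathbb T\right\}.$$ Let $m\in\mathbb N$, $D>0$, and assume that there are points $\xi^1,\dots,\xi^m\in\mathbb T$ (not necessarily distinct) such that $$\left(\frac1m\sum_{j=1}^m|f(\xi^j)|^q\right)^{1/q}\le D\|f\|_p\qquad\text{for all } f\in\mathcal T(\Lambda_N).$$ Then $$N^{q/2}\le m\,C(p,q,b)\,D^q.$$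
   Context: $\mathbb T=\mathbb R/2\pi\mathbb Z$ is equipped with the normalized Lebesgue (probability) measure, $\|f\|_p$ is the corresponding $L_p$-norm, and the coefficients $c_k$ are complex numbers. *)

theory Defs
  imports "HOL-Analysis.Analysis"
begin

text \<open>
  Functions on the circle \<open>\<real>/2\<pi>\<int>\<close> are represented by \<open>2\<pi>\<close>-periodic functions on the real line,
  and points of the circle by arbitrary real representatives.
\<close>

definition circle_Lp_norm :: "real \<Rightarrow> (real \<Rightarrow> complex) \<Rightarrow> real" where
  "circle_Lp_norm p f =
     ((1 / (2 * pi)) * (LINT x:{0..2 * pi}|lborel. norm (f x) powr p)) powr (1 / p)"

definition trig_polys :: "nat set \<Rightarrow> (real \<Rightarrow> complex) set" where
  "trig_polys \<Lambda> =
     {f. \<exists>c :: nat \<Rightarrow> complex. f = (\<lambda>x. \<Sum>k\<in>\<Lambda>. c k * exp (\<i> * of_nat k * of_real x))}"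

lemma trig_polys_periodic:
  assumes "f \<in> trig_polys \<Lambda>"
  shows "f (x + 2 * pi) = f x"
proof -
  have "exp (\<i> * of_nat k * of_real (x + 2 * pi)) = exp (\<i> * of_nat k * of_real x)" for k :: nat
  proof -
    have "\<i> * of_nat k * of_real (x + 2 * pi)
        = \<i> * of_nat k * of_real x + \<i> * (of_int (int k) * (of_real pi * 2))"
      by (simp add: algebra_simps)
    then show ?thesis
      by (simp only: exp_plus_2pin)
  qed
  then show ?thesis
    using assms by (auto simp: trig_polys_def)
qed

text \<open>The sequence is indexed from 1, so only the values \<open>k 1, \<dots>, k N\<close> are constrained.\<close>

definition lacunary :: "real \<Rightarrow> nat \<Rightarrow> (nat \<Rightarrow> nat) \<Rightarrow> bool" where
  "lacunary b N k \<longleftrightarrow>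
     (\<forall>i\<in>{1..N}. 0 < k i) \<and> (\<forall>i\<in>{1..<N}. real (k (i + 1)) \<ge> b * real (k i))"

end

theory Submission
  imports Defs
begin

text \<open>
  Only one of the points matters: testing the hypothesis on the polynomial
  \<open>f(x) = \<Sum>\<^sub>k exp(ik(x - \<xi>\<^sup>1))\<close> gives \<open>N\<^sup>q / m \<le> D\<^sup>q \<parallel>f\<parallel>\<^sub>p\<^sup>q\<close>, so it suffices to know
  \<open>\<parallel>f\<parallel>\<^sub>p \<le> K N\<^bsup>1/2\<^esup>\<close> for lacunary spectra and unimodular coefficients. This follows from an
  exponential moment bound: convexity gives
  \<open>exp(\<tau> cos t) \<le> cosh \<tau> + sinh \<tau> cos t\<close>, and when each frequency is at least twice the previous
  one, the product of these bounds is a Riesz product, whose mean is \<open>(cosh \<tau>)\<^sup>N \<le> exp(\<tau>\<^sup>2 N)\<close>. For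
  a ratio \<open>b < 2\<close>, the spectrum is split into \<open>r\<close> such subsequences (with \<open>b\<^sup>r \<ge> 2\<close>) and the
  exponential of their average is bounded by convexity.
\<close>

section \<open>Riesz products\<close>

text \<open>Lacunarity of ratio 2 is stated for a set rather than a sequence, so that it passes to
  subsets; the inductions below remove the largest frequency.\<close>

definition doubling :: "nat set \<Rightarrow> bool" where
  "doubling S \<longleftrightarrow> 0 \<notin> S \<and> (\<forall>s\<in>S. \<forall>t\<in>S. s < t \<longrightarrow> 2 * s \<le> t)"

lemma doubling_subset: "doubling S \<Longrightarrow> T \<subseteq> S \<Longrightarrow> doubling T"
  unfolding doubling_def by blast

text \<open>Induction on the largest element \<open>s\<close>: the elements below it already sum to
  less than \<open>s\<close>, so the total is less than \<open>2 * s\<close>, hence less than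
  \<open>t\<close>.\<close>

lemma doubling_sum_less:
  assumes "finite S" "doubling S" "0 < t" "\<And>s. s \<in> S \<Longrightarrow> 2 * s \<le> t"
  shows "\<Sum>S < t"
  using assms
proof (induction S arbitrary: t rule: finite_linorder_max_induct)
  case empty
  then show ?case by simp
next
  case (insert s S)
  have D: "doubling S"
    using insert.prems(1) by (rule doubling_subset) auto
  have "s \<noteq> 0" "\<And>a. a \<in> S \<Longrightarrow> 2 * a \<le> s"
    using insert.hyps insert.prems(1) by (auto simp: doubling_def)
  then have "\<Sum>S < s"
    using D by (intro insert.IH) auto
  then show ?case
    using insert.hyps insert.prems(3)[of s] by (subst sum.insert) auto
qed

lemma doubling_insert_sum_less:
  assumes "finite S" "\<forall>s\<in>S. s < t" "doubling (insert t S)"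
  shows "\<Sum>S < t"
proof (rule doubling_sum_less[OF assms(1)])
  show "doubling S"
    using assms(3) by (rule doubling_subset) auto
qed (use assms in \<open>auto simp: doubling_def\<close>)

lemma integral_cos_period:
  assumes "0 < j"
  shows "integral {0..2 * pi} (\<lambda>x. cos (real j * x + \<psi>)) = 0"
proof -
  have "((\<lambda>x. cos (real j * x + \<psi>)) has_integral
      sin (real j * (2 * pi) + \<psi>) / real j - sin (real j * 0 + \<psi>) / real j) {0..2 * pi}"
  proof (rule fundamental_theorem_of_calculus)
    fix x :: real
    have "((\<lambda>x. sin (real j * x + \<psi>) / real j) has_real_derivative cos (real j * x + \<psi>))
        (at x within {0..2 * pi})"
      using assms by (auto intro!: derivative_eq_intros)
    then show "((\<lambda>x. sin (real j * x + \<psi>) / real j) has_vector_derivative cos (real j * x + \<psi>))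
        (at x within {0..2 * pi})"
      by (simp add: has_real_derivative_iff_has_vector_derivative)
  qed simp
  moreover have "sin (real j * (2 * pi) + \<psi>) = sin \<psi>"
    using sin.plus_of_nat[of \<psi> j] by (simp add: algebra_simps)
  ultimately show ?thesis
    by (simp add: integral_unique)
qed

text \<open>The constant term is \<open>a\<close> instead of the classical 1, to match the bound by
  \<open>cosh \<tau>\<close> and \<open>sinh \<tau>\<close> times a cosine. The free phases
  \<open>\<phi>\<close> absorb unimodular coefficients and allow passing from cosines to
  sines.\<close>

definition riesz_product ::
    "real \<Rightarrow> real \<Rightarrow> (nat \<Rightarrow> real) \<Rightarrow> nat set \<Rightarrow> real \<Rightarrow> real" where
  "riesz_product a b \<phi> S x = (\<Prod>s\<in>S. a + b * cos (real s * x + \<phi> s))"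

lemma continuous_on_riesz_product [continuous_intros]:
  "continuous_on A (riesz_product a b \<phi> S)"
  unfolding riesz_product_def by (intro continuous_intros)

lemma riesz_product_integrable:
  "(\<lambda>x. riesz_product a b \<phi> S x * cos (c * x + \<psi>)) integrable_on {0..2 * pi}"
  by (intro integrable_continuous_real continuous_intros)

text \<open>Every frequency of the product is at most \<open>\<Sum>S\<close> in absolute value, so
  multiplying by a cosine of higher frequency leaves no constant term. In the induction, removing
  the largest \<open>s\<close> replaces \<open>j\<close> by \<open>j\<close>, \<open>j - s\<close>
  and \<open>j + s\<close>, all still above the sum of the remaining frequencies; hence
  \<open>j\<close> and the phase must vary.\<close>

lemma integral_riesz_product_mult_cos:
  assumes "finite S" "doubling S" "\<Sum>S < j"
  shows "integral {0..2 * pi} (\<lambda>x. riesz_product a b \<phi> S x * cos (real j * x + \<psi>)) = 0"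
  using assms
proof (induction S arbitrary: j \<psi> rule: finite_linorder_max_induct)
  case empty
  then show ?case
    by (simp add: riesz_product_def integral_cos_period)
next
  case (insert s S)
  let ?P = "riesz_product a b \<phi> S"
  have "s \<notin> S" using insert.hyps by auto
  have D: "doubling S"
    using insert.prems(1) by (rule doubling_subset) auto
  have j: "\<Sum>S + s < j"
    using insert.prems(2) insert.hyps \<open>s \<notin> S\<close> by simp
  have expand: "riesz_product a b \<phi> (insert s S) x * cos (real j * x + \<psi>) =
      a * (?P x * cos (real j * x + \<psi>))
      + (b / 2) * (?P x * cos (real (j - s) * x + (\<psi> - \<phi> s)))
      + (b / 2) * (?P x * cos (real (j + s) * x + (\<psi> + \<phi> s)))" for x
  proof -
    have "cos (real s * x + \<phi> s) * cos (real j * x + \<psi>) =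
        (cos (real (j - s) * x + (\<psi> - \<phi> s)) + cos (real (j + s) * x + (\<psi> + \<phi> s))) / 2"
      \<comment> \<open>The natural subtraction \<open>j - s\<close> is exact because
        \<open>s < j\<close>.\<close>
      using j by (subst mult.commute, subst cos_times_cos) (simp add: of_nat_diff algebra_simps)
    then have eq: "b * (?P x * (cos (real s * x + \<phi> s) * cos (real j * x + \<psi>))) =
        b * (?P x * ((cos (real (j - s) * x + (\<psi> - \<phi> s)) + cos (real (j + s) * x + (\<psi> + \<phi> s))) / 2))"
      by simp
    have "riesz_product a b \<phi> (insert s S) x * cos (real j * x + \<psi>) =
        a * (?P x * cos (real j * x + \<psi>))
        + b * (?P x * (cos (real s * x + \<phi> s) * cos (real j * x + \<psi>)))"
      unfolding riesz_product_def using insert.hyps(1) \<open>s \<notin> S\<close>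
      by (simp add: algebra_simps)
    then show ?thesis
      unfolding eq by (simp add: field_simps)
  qed
  have zero: "integral {0..2 * pi} (\<lambda>x. ?P x * cos (real i * x + \<theta>)) = 0" if "\<Sum>S < i" for i \<theta>
    using insert.IH[OF D that] .
  have int: "(\<lambda>x. c * (?P x * cos (d * x + \<theta>))) integrable_on {0..2 * pi}" for c d \<theta>
    by (intro integrable_on_mult_right riesz_product_integrable)
  show ?case
    unfolding expand using j
    by (simp add: integral_add integrable_add int zero del: of_nat_add of_nat_diff)
qed

text \<open>The largest frequency exceeds the sum of the smaller ones, so its cosine is orthogonal
  to the remaining product. Each factor thus contributes only its constant term
  \<open>a\<close>.\<close>

lemma integral_riesz_product:
  assumes "finite S" "doubling S"
  shows "integral {0..2 * pi} (riesz_product a b \<phi> S) = 2 * pi * a ^ card S"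
  using assms
proof (induction S rule: finite_linorder_max_induct)
  case empty
  then show ?case
    by (simp add: riesz_product_def)
next
  case (insert s S)
  let ?P = "riesz_product a b \<phi> S"
  have "s \<notin> S" using insert.hyps by auto
  have D: "doubling S"
    using insert.prems(1) by (rule doubling_subset) auto
  have "riesz_product a b \<phi> (insert s S) = (\<lambda>x. a * ?P x + b * (?P x * cos (real s * x + \<phi> s)))"
    using insert.hyps(1) \<open>s \<notin> S\<close>
    by (simp add: fun_eq_iff riesz_product_def algebra_simps)
  moreover have "integral {0..2 * pi} (\<lambda>x. a * ?P x + b * (?P x * cos (real s * x + \<phi> s))) =
      integral {0..2 * pi} (\<lambda>x. a * ?P x)
      + integral {0..2 * pi} (\<lambda>x. b * (?P x * cos (real s * x + \<phi> s)))"
    by (intro integral_add integrable_on_mult_right riesz_product_integrable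
        integrable_continuous_real continuous_intros)
  moreover have "integral {0..2 * pi} (\<lambda>x. ?P x * cos (real s * x + \<phi> s)) = 0"
    using insert.hyps insert.prems D
    by (intro integral_riesz_product_mult_cos doubling_insert_sum_less) auto
  ultimately show ?case
    using insert.IH[OF D] insert.hyps(1) \<open>s \<notin> S\<close> by simp
qed

section \<open>Exponential moments\<close>

text \<open>As a function of \<open>c\<close>, the right-hand side is the chord of the convex
  function \<open>exp (\<tau> * c)\<close> between \<open>c = -1\<close> and
  \<open>c = 1\<close>.\<close>

lemma exp_mult_le_cosh_sinh:
  fixes c \<tau> :: real
  assumes "\<bar>c\<bar> \<le> 1"
  shows "exp (\<tau> * c) \<le> cosh \<tau> + sinh \<tau> * c"
proof -
  have "exp ((1 - (1 + c) / 2) *\<^sub>R (- \<tau>) + ((1 + c) / 2) *\<^sub>R \<tau>)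
      \<le> (1 - (1 + c) / 2) * exp (- \<tau>) + ((1 + c) / 2) * exp \<tau>"
    using assms by (intro convex_onD[OF exp_convex]) auto
  then show ?thesis
    by (simp add: cosh_def sinh_def field_simps)
qed

lemma cosh_le_exp_square:
  fixes \<tau> :: real
  assumes "0 \<le> \<tau>" "\<tau> \<le> 1"
  shows "cosh \<tau> \<le> exp (\<tau>\<^sup>2)"
proof -
  have "exp \<tau> \<le> 1 + \<tau> + \<tau>\<^sup>2"
    using assms by (intro exp_bound)
  moreover have "exp (- \<tau>) \<le> 1 - \<tau> + \<tau>\<^sup>2"
  proof -
    have "exp (- \<tau>) \<le> 1 / (1 + \<tau>)"
      using assms exp_ge_add_one_self[of \<tau>] by (simp add: exp_minus field_simps)
    \<comment> \<open>After clearing the denominator, the product on the right is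
      \<open>1 + \<tau> ^ 3\<close>, which is at least 1.\<close>
    also have "\<dots> \<le> 1 - \<tau> + \<tau>\<^sup>2"
      using assms by (simp add: field_simps power2_eq_square)
    finally show ?thesis .
  qed
  ultimately have "cosh \<tau> \<le> 1 + \<tau>\<^sup>2"
    by (simp add: cosh_def)
  also have "\<dots> \<le> exp (\<tau>\<^sup>2)"
    by (rule exp_ge_add_one_self)
  finally show ?thesis .
qed

text \<open>The exponential of the sum factors, and the chord bound turns the factors into those of
  a Riesz product, whose integral depends only on \<open>cosh \<tau>\<close> and the number of
  factors.\<close>

lemma exp_moment_doubling:
  assumes "finite S" "doubling S" "0 \<le> \<tau>" "\<tau> \<le> 1"
  shows "integral {0..2 * pi} (\<lambda>x. exp (\<tau> * (\<Sum>s\<in>S. cos (real s * x + \<phi> s))))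
    \<le> 2 * pi * exp (\<tau>\<^sup>2 * real (card S))"
proof -
  have "integral {0..2 * pi} (\<lambda>x. exp (\<tau> * (\<Sum>s\<in>S. cos (real s * x + \<phi> s))))
      \<le> integral {0..2 * pi} (riesz_product (cosh \<tau>) (sinh \<tau>) \<phi> S)"
  proof (rule integral_le)
    fix x
    have "exp (\<tau> * (\<Sum>s\<in>S. cos (real s * x + \<phi> s))) = (\<Prod>s\<in>S. exp (\<tau> * cos (real s * x + \<phi> s)))"
      using assms(1) by (simp add: sum_distrib_left exp_sum)
    also have "\<dots> \<le> riesz_product (cosh \<tau>) (sinh \<tau>) \<phi> S x"
      unfolding riesz_product_def by (intro prod_mono conjI exp_mult_le_cosh_sinh) auto
    finally show "exp (\<tau> * (\<Sum>s\<in>S. cos (real s * x + \<phi> s))) \<le>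
        riesz_product (cosh \<tau>) (sinh \<tau>) \<phi> S x" .
  qed (auto intro!: integrable_continuous_real continuous_intros)
  also have "\<dots> = 2 * pi * cosh \<tau> ^ card S"
    using assms(1,2) by (rule integral_riesz_product)
  also have "\<dots> \<le> 2 * pi * exp (\<tau>\<^sup>2) ^ card S"
    using assms(3,4) by (intro mult_left_mono power_mono cosh_le_exp_square) auto
  finally show ?thesis
    by (simp add: exp_of_nat2_mult)
qed

text \<open>Dividing by \<open>r\<close> makes the exponent an average of the \<open>r\<close> block
  exponents, so Jensen's inequality reduces the claim to single blocks. Each block is no larger than
  the union, which gives all of them the same bound.\<close>

lemma exp_moment_Union_doubling:
  fixes S :: "nat \<Rightarrow> nat set"
  assumes r: "0 < r" and fin: "\<And>c. c < r \<Longrightarrow> finite (S c)"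
    and dbl: "\<And>c. c < r \<Longrightarrow> doubling (S c)"
    and disj: "\<And>c d. c < r \<Longrightarrow> d < r \<Longrightarrow> c \<noteq> d \<Longrightarrow> S c \<inter> S d = {}"
    and \<tau>: "0 \<le> \<tau>" "\<tau> \<le> 1"
  shows "integral {0..2 * pi} (\<lambda>x. exp (\<tau> / real r * (\<Sum>s\<in>(\<Union>c<r. S c). cos (real s * x + \<phi> s))))
    \<le> 2 * pi * exp (\<tau>\<^sup>2 * real (card (\<Union>c<r. S c)))"
proof -
  let ?g = "\<lambda>c x. \<tau> * (\<Sum>s\<in>S c. cos (real s * x + \<phi> s))"
  have "integral {0..2 * pi} (\<lambda>x. exp (\<tau> / real r * (\<Sum>s\<in>(\<Union>c<r. S c). cos (real s * x + \<phi> s))))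
      \<le> integral {0..2 * pi} (\<lambda>x. \<Sum>c<r. 1 / real r * exp (?g c x))"
  proof (rule integral_le)
    fix x
    have "(\<Sum>s\<in>(\<Union>c<r. S c). cos (real s * x + \<phi> s)) = (\<Sum>c<r. \<Sum>s\<in>S c. cos (real s * x + \<phi> s))"
      using fin disj by (intro sum.UNION_disjoint) auto
    then have "\<tau> / real r * (\<Sum>s\<in>(\<Union>c<r. S c). cos (real s * x + \<phi> s))
        = (\<Sum>c<r. (1 / real r) *\<^sub>R ?g c x)"
      by (simp add: sum_distrib_left mult_ac)
    moreover have "exp (\<Sum>c<r. (1 / real r) *\<^sub>R ?g c x) \<le> (\<Sum>c<r. 1 / real r * exp (?g c x))"
      using r by (intro convex_on_sum[OF _ _ exp_convex]) auto
    ultimately show "exp (\<tau> / real r * (\<Sum>s\<in>(\<Union>c<r. S c). cos (real s * x + \<phi> s)))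
        \<le> (\<Sum>c<r. 1 / real r * exp (?g c x))"
      by simp
  qed (use r in \<open>auto intro!: integrable_continuous_real continuous_intros\<close>)
  also have "\<dots> = (\<Sum>c<r. 1 / real r * integral {0..2 * pi} (\<lambda>x. exp (?g c x)))"
    by (subst integral_sum) (auto intro!: integrable_continuous_real continuous_intros)
  also have "\<dots> \<le> (\<Sum>c<r. 1 / real r * (2 * pi * exp (\<tau>\<^sup>2 * real (card (\<Union>c<r. S c)))))"
  proof (intro sum_mono mult_left_mono)
    fix c assume c: "c \<in> {..<r}"
    have "card (S c) \<le> card (\<Union>c<r. S c)"
      using c fin by (intro card_mono) auto
    then have "exp (\<tau>\<^sup>2 * real (card (S c))) \<le> exp (\<tau>\<^sup>2 * real (card (\<Union>c<r. S c)))"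
      by (simp add: mult_left_mono)
    then show "integral {0..2 * pi} (\<lambda>x. exp (?g c x))
        \<le> 2 * pi * exp (\<tau>\<^sup>2 * real (card (\<Union>c<r. S c)))"
      using c exp_moment_doubling[OF fin dbl \<tau>, of c \<phi>]
      by (smt (verit) lessThan_iff mult_left_mono pi_gt_zero)
  qed simp
  also have "\<dots> = 2 * pi * exp (\<tau>\<^sup>2 * real (card (\<Union>c<r. S c)))"
    using r by simp
  finally show ?thesis .
qed

section \<open>Lacunary sequences\<close>

lemma lacunary_growth:
  assumes "1 < b" "lacunary b N k" "1 \<le> i" "i + n \<le> N"
  shows "b ^ n * real (k i) \<le> real (k (i + n))"
  using assms(4)
proof (induction n)
  case 0
  then show ?case by simp
next
  case (Suc n)
  have "b ^ Suc n * real (k i) \<le> b * real (k (i + n))"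
    using Suc assms(1) by simp
  also have "\<dots> \<le> real (k (i + n + 1))"
    using assms(2,3) Suc.prems by (auto simp: lacunary_def)
  finally show ?case by simp
qed

lemma lacunary_strict_mono_on:
  assumes "1 < b" "lacunary b N k"
  shows "strict_mono_on {1..N} k"
proof (rule strict_mono_onI)
  fix i j assume ij: "i \<in> {1..N}" "j \<in> {1..N}" "i < j"
  have "0 < k i"
    using assms(2) ij by (auto simp: lacunary_def)
  moreover have "1 < b ^ (j - i)"
    using assms(1) ij by (intro one_less_power) auto
  ultimately have "real (k i) < b ^ (j - i) * real (k i)"
    by simp
  also have "\<dots> \<le> real (k j)"
    using lacunary_growth[OF assms, of i "j - i"] ij by simp
  finally show "k i < k j" by simp
qed

text \<open>Distinct indices in one residue class differ by at least \<open>r\<close>, so their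
  frequencies have ratio at least \<open>b ^ r\<close>.\<close>

lemma doubling_residue_class:
  assumes "1 < b" "lacunary b N k" "2 \<le> b ^ r"
  shows "doubling (k ` {i\<in>{1..N}. i mod r = c})"
  unfolding doubling_def
proof (intro conjI ballI impI)
  show "0 \<notin> k ` {i\<in>{1..N}. i mod r = c}"
    using assms(2) by (force simp: lacunary_def)
next
  fix s t
  assume "s \<in> k ` {i\<in>{1..N}. i mod r = c}" "t \<in> k ` {i\<in>{1..N}. i mod r = c}" and "s < t"
  then obtain i j where ij: "i \<in> {1..N}" "j \<in> {1..N}" "i mod r = j mod r" "s = k i" "t = k j"
    by auto
  have "i < j"
    using strict_mono_on_less[OF lacunary_strict_mono_on[OF assms(1,2)]] ij \<open>s < t\<close> by simp
  then have "r dvd j - i" "0 < j - i"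
    using ij(3) mod_eq_dvd_iff_nat[of i j r] by auto
  then have "r \<le> j - i"
    by (rule dvd_imp_le)
  then have "b ^ r \<le> b ^ (j - i)"
    using assms(1) by (intro power_increasing) auto
  then have "2 * real (k i) \<le> b ^ (j - i) * real (k i)"
    using assms(3) by (intro mult_right_mono) auto
  also have "\<dots> \<le> real (k j)"
    using lacunary_growth[OF assms(1,2), of i "j - i"] ij \<open>i < j\<close> by simp
  finally show "2 * s \<le> t"
    using ij by simp
qed

lemma exp_moment_lacunary:
  assumes "1 < b" "lacunary b N k" "2 \<le> b ^ r" "0 \<le> \<tau>" "\<tau> \<le> 1"
  shows "integral {0..2 * pi} (\<lambda>x. exp (\<tau> / real r * (\<Sum>s\<in>k ` {1..N}. cos (real s * x + \<phi> s))))
    \<le> 2 * pi * exp (\<tau>\<^sup>2 * real N)"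
proof -
  let ?S = "\<lambda>c. k ` {i\<in>{1..N}. i mod r = c}"
  have r: "0 < r"
    using assms(3) by (cases r) auto
  have inj: "inj_on k {1..N}"
    using lacunary_strict_mono_on[OF assms(1,2)] by (rule strict_mono_on_imp_inj_on)
  \<comment> \<open>The residue classes of the indices give the \<open>r\<close> blocks; injectivity
    of \<open>k\<close> keeps their images disjoint.\<close>
  have "{1..N} = (\<Union>c<r. {i\<in>{1..N}. i mod r = c})"
    using r by auto
  then have U: "k ` {1..N} = (\<Union>c<r. ?S c)"
    unfolding image_UN[symmetric] by (rule arg_cong)
  have "?S c \<inter> ?S d = {}" if "c \<noteq> d" for c d
    using that inj by (fastforce dest: inj_onD)
  moreover have "card (k ` {1..N}) = N"
    using card_image[OF inj] by simp
  ultimately show ?thesis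
    using exp_moment_Union_doubling[OF r, of ?S \<tau> \<phi>] doubling_residue_class[OF assms(1-3)] assms(4,5)
    unfolding U by simp
qed

section \<open>From exponential moments to \<open>L_p\<close> norms\<close>

text \<open>This is \<open>t / p \<le> exp (t / p)\<close> raised to the power
  \<open>p\<close>.\<close>

lemma powr_le_exp:
  fixes t p :: real
  assumes "0 < p" "0 \<le> t"
  shows "t powr p \<le> p powr p * exp t"
proof -
  have "t \<le> p * exp (t / p)"
    using assms exp_ge_add_one_self[of "t / p"] by (simp add: field_simps)
  then have "t powr p \<le> (p * exp (t / p)) powr p"
    using assms by (intro powr_mono2) auto
  also have "\<dots> = p powr p * exp t"
    using assms by (subst powr_mult) (simp_all add: powr_def)
  finally show ?thesis .
qed

text \<open>The modulus is at most twice the larger of \<open>\<bar>Re z\<bar>\<close> and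
  \<open>\<bar>Im z\<bar>\<close>, and the exponential of that maximum is one of the four terms on
  the right.\<close>

lemma norm_powr_le_exp_parts:
  fixes z :: complex and p :: real
  assumes "0 < p"
  shows "norm z powr p \<le> (2 * p) powr p *
    (exp (Re z) + exp (- Re z) + exp (Im z) + exp (- Im z))"
proof -
  let ?M = "max \<bar>Re z\<bar> \<bar>Im z\<bar>"
  have "norm z powr p \<le> (2 * ?M) powr p"
    using assms cmod_le[of z] by (intro powr_mono2) auto
  also have "\<dots> = 2 powr p * ?M powr p"
    by (simp add: powr_mult)
  also have "\<dots> \<le> 2 powr p * (p powr p * exp ?M)"
    using assms by (intro mult_left_mono powr_le_exp) auto
  also have "\<dots> = (2 * p) powr p * exp ?M"
    using assms by (simp add: powr_mult)
  also have "\<dots> \<le> (2 * p) powr p *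
      (exp (Re z) + exp (- Re z) + exp (Im z) + exp (- Im z))"
  proof (rule mult_left_mono)
    show "exp ?M \<le> exp (Re z) + exp (- Re z) + exp (Im z) + exp (- Im z)"
      using exp_gt_zero[of "Re z"] exp_gt_zero[of "- Re z"] exp_gt_zero[of "Im z"]
        exp_gt_zero[of "- Im z"]
      by (smt (verit))
  qed simp
  finally show ?thesis .
qed

lemma continuous_on_norm_powr:
  fixes f :: "'a::topological_space \<Rightarrow> 'b::real_normed_vector"
  assumes "continuous_on A f" "0 < p"
  shows "continuous_on A (\<lambda>x. norm (f x) powr p)"
  using assms by (intro continuous_on_powr' continuous_on_norm continuous_on_const) auto

text \<open>Replaces the Lebesgue integral of the definition by the gauge integral used in the
  moment bounds.\<close>

lemma circle_Lp_norm_eq_integral: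
  assumes "continuous_on {0..2 * pi} f" "0 < p"
  shows "circle_Lp_norm p f =
    (1 / (2 * pi) * integral {0..2 * pi} (\<lambda>x. norm (f x) powr p)) powr (1 / p)"
proof -
  have "set_integrable lborel {0..2 * pi} (\<lambda>x. norm (f x) powr p)"
    unfolding set_integrable_def using assms
    by (intro borel_integrable_compact continuous_on_norm_powr) auto
  then show ?thesis
    unfolding circle_Lp_norm_def by (simp add: set_borel_integral_eq_integral)
qed

lemma circle_Lp_norm_lacunary_le:
  assumes "1 < b" "lacunary b N k" "2 \<le> b ^ r" "0 < p" "1 \<le> N"
  shows "circle_Lp_norm p (\<lambda>x. \<Sum>s\<in>k ` {1..N}. cis (real s * x + \<phi> s))
    \<le> 2 * p * real r * (4 * exp 1) powr (1 / p) * sqrt (real N)"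
proof -
  \<comment> \<open>The moment bound is used with \<open>\<tau> = 1 / sqrt (real N)\<close>, for
    which \<open>exp (\<tau>\<^sup>2 * real N)\<close> is \<open>exp 1\<close>; the further division
    by \<open>r\<close> is the one required by the splitting into blocks.\<close>
  define \<mu> where "\<mu> = 1 / sqrt (real N) / real r"
  define f where "f = (\<lambda>x. \<Sum>s\<in>k ` {1..N}. cis (real s * x + \<phi> s))"
  \<comment> \<open>The shifts \<open>0\<close>, \<open>pi\<close>, \<open>- pi / 2\<close> and
    \<open>pi / 2\<close> of \<open>\<psi>\<close> turn the cosine sum into the real part of
    \<open>f x\<close>, its negative, the imaginary part and its negative.\<close>
  let ?E = "\<lambda>\<psi> x. exp (\<mu> * (\<Sum>s\<in>k ` {1..N}. cos (real s * x + (\<phi> s + \<psi>))))"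
  have r: "0 < r"
    using assms(3) by (cases r) auto
  have \<mu>: "0 < \<mu>"
    using r assms(5) by (simp add: \<mu>_def)
  have contf: "continuous_on {0..2 * pi} f"
    unfolding f_def by (intro continuous_intros)
  have E: "integral {0..2 * pi} (?E \<psi>) \<le> 2 * pi * exp 1" for \<psi>
    using exp_moment_lacunary[OF assms(1-3), of "1 / sqrt (real N)" "\<lambda>s. \<phi> s + \<psi>"] assms(5)
    by (simp add: \<mu>_def power_divide)
  have intE: "?E \<psi> integrable_on {0..2 * pi}" for \<psi>
    by (intro integrable_continuous_real continuous_intros)
  have bound: "norm (f x) powr p \<le> (2 * p / \<mu>) powr p *
      (?E 0 x + ?E pi x + ?E (- pi / 2) x + ?E (pi / 2) x)" for x
  proof -
    have cos_shift: "cos (y + (u + pi)) = - cos (y + u)" "cos (y + (u - pi / 2)) = sin (y + u)"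
      "cos (y + (u + pi / 2)) = - sin (y + u)" for y u :: real
      by (simp_all add: add.assoc[symmetric] cos_add sin_add cos_diff sin_diff add_diff_eq)
    have "norm (of_real \<mu> * f x) powr p \<le> (2 * p) powr p *
        (?E 0 x + ?E pi x + ?E (- pi / 2) x + ?E (pi / 2) x)"
      using norm_powr_le_exp_parts[OF assms(4), of "of_real \<mu> * f x"]
      by (simp add: f_def cos_shift sum_negf)
    then show ?thesis
      using \<mu> assms(4) by (simp add: norm_mult powr_mult powr_divide field_simps)
  qed
  have "integral {0..2 * pi} (\<lambda>x. norm (f x) powr p) \<le> integral {0..2 * pi} (\<lambda>x. (2 * p / \<mu>) powr p *
      (?E 0 x + ?E pi x + ?E (- pi / 2) x + ?E (pi / 2) x))"
    using contf assms(4)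
    by (intro integral_le bound integrable_on_mult_right integrable_add intE)
      (auto intro!: integrable_continuous_real continuous_on_norm_powr)
  also have "\<dots> = (2 * p / \<mu>) powr p * (integral {0..2 * pi} (?E 0) + integral {0..2 * pi} (?E pi)
      + integral {0..2 * pi} (?E (- pi / 2)) + integral {0..2 * pi} (?E (pi / 2)))"
    by (simp only: integral_mult_right integral_add integrable_add intE)
  also have "\<dots> \<le> (2 * p / \<mu>) powr p * (4 * (2 * pi * exp 1))"
    using E[of 0] E[of pi] E[of "- pi / 2"] E[of "pi / 2"] by (intro mult_left_mono powr_ge_zero) linarith
  finally have "1 / (2 * pi) * integral {0..2 * pi} (\<lambda>x. norm (f x) powr p)
      \<le> (2 * p / \<mu>) powr p * (4 * exp 1)"
    by (simp add: field_simps)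
  moreover have "0 \<le> integral {0..2 * pi} (\<lambda>x. norm (f x) powr p)"
    using contf assms(4)
    by (intro integral_nonneg integrable_continuous_real continuous_on_norm_powr) auto
  ultimately have "circle_Lp_norm p f \<le> ((2 * p / \<mu>) powr p * (4 * exp 1)) powr (1 / p)"
    unfolding circle_Lp_norm_eq_integral[OF contf assms(4)]
    using assms(4) by (intro powr_mono2) auto
  also have "\<dots> = 2 * p / \<mu> * (4 * exp 1) powr (1 / p)"
    using assms(4) \<mu> by (subst powr_mult) (simp_all add: powr_powr)
  \<comment> \<open>Here \<open>1 / \<mu>\<close> equals \<open>r\<close> times the square root of
    \<open>N\<close>, the source of the square-root growth.\<close>
  also have "\<dots> = 2 * p * real r * (4 * exp 1) powr (1 / p) * sqrt (real N)"
    by (simp add: \<mu>_def)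
  finally show ?thesis
    unfolding f_def .
qed

section \<open>Conclusion from a single test polynomial\<close>

theorem corollary2p1:
  fixes b p q :: real
  assumes "1 < b" and "2 < p" and "2 < q"
  shows "\<exists>C::real. 0 < C \<and>
    (\<forall>(N::nat) (k :: nat \<Rightarrow> nat) (m::nat) (D::real) (\<xi> :: nat \<Rightarrow> real).
       1 \<le> N \<longrightarrow> lacunary b N k \<longrightarrow> 1 \<le> m \<longrightarrow> 0 < D \<longrightarrow>
       (\<forall>f \<in> trig_polys (k ` {1..N}).
          ((1 / real m) * (\<Sum>j=1..m. norm (f (\<xi> j)) powr q)) powr (1 / q)
            \<le> D * circle_Lp_norm p f) \<longrightarrow>
       real N powr (q / 2) \<le> real m * C * D powr q)"
proof -
  \<comment> \<open>Both \<open>r\<close> and the constant \<open>K\<close> below are fixed before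
    \<open>N\<close>, \<open>k\<close>, \<open>m\<close>, \<open>D\<close> and \<open>\<xi>\<close>,
    so the final constant \<open>K powr q\<close> depends only on \<open>b\<close>, \<open>p\<close>
    and \<open>q\<close>.\<close>
  obtain r where r: "2 \<le> b ^ r"
    using real_arch_pow[OF assms(1), of 2] by (auto intro: less_imp_le)
  then have "0 < r"
    by (cases r) auto
  define K where "K = 2 * p * real r * (4 * exp 1) powr (1 / p)"
  have K: "0 < K"
    using assms(2) \<open>0 < r\<close> by (simp add: K_def)
  show ?thesis
  proof (intro exI[of _ "K powr q"] conjI allI impI)
    show "0 < K powr q"
      using K by simp
  next
    fix N :: nat and k :: "nat \<Rightarrow> nat" and m :: nat and D :: real and \<xi> :: "nat \<Rightarrow> real"
    assume N: "1 \<le> N" and lac: "lacunary b N k" and m: "1 \<le> m" and D: "0 < D"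
      and disc: "\<forall>f \<in> trig_polys (k ` {1..N}).
          ((1 / real m) * (\<Sum>j=1..m. norm (f (\<xi> j)) powr q)) powr (1 / q)
            \<le> D * circle_Lp_norm p f"
    \<comment> \<open>The phases make every summand equal to 1 at \<open>\<xi> 1\<close>, so
      \<open>f\<close> takes the value \<open>N\<close> there.\<close>
    define f where "f = (\<lambda>x. \<Sum>s\<in>k ` {1..N}. cis (real s * x + - (real s * \<xi> 1)))"
    have "f = (\<lambda>x. \<Sum>s\<in>k ` {1..N}. cis (- (real s * \<xi> 1)) * exp (\<i> * of_nat s * of_real x))"
      unfolding f_def by (simp only: cis_mult[symmetric]) (simp add: cis_conv_exp mult_ac)
    then have mem: "f \<in> trig_polys (k ` {1..N})"
      by (auto simp: trig_polys_def)
    have "card (k ` {1..N}) = N"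
      using card_image[OF strict_mono_on_imp_inj_on[OF lacunary_strict_mono_on[OF assms(1) lac]]]
      by simp
    then have "norm (f (\<xi> 1)) = real N"
      by (simp add: f_def)
    then have "real N powr q \<le> (\<Sum>j=1..m. norm (f (\<xi> j)) powr q)"
      using m member_le_sum[of 1 "{1..m}" "\<lambda>j. norm (f (\<xi> j)) powr q"] by simp
    then have "(1 / real m * real N powr q) powr (1 / q)
        \<le> (1 / real m * (\<Sum>j=1..m. norm (f (\<xi> j)) powr q)) powr (1 / q)"
      using assms(3) by (intro powr_mono2 mult_left_mono) auto
    also have "\<dots> \<le> D * circle_Lp_norm p f"
      using disc mem by blast
    also have "\<dots> \<le> D * (K * sqrt (real N))"
      unfolding f_def K_def using D N assms(2)
      by (intro mult_left_mono circle_Lp_norm_lacunary_le[OF assms(1) lac r]) auto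
    finally have "((1 / real m * real N powr q) powr (1 / q)) powr q \<le> (D * (K * sqrt (real N))) powr q"
      using assms(3) by (intro powr_mono2) auto
    then have "1 / real m * real N powr q \<le> D powr q * (K powr q * real N powr (q / 2))"
      using D K assms(3) by (simp add: powr_powr powr_mult powr_half_sqrt[symmetric])
    \<comment> \<open>One factor \<open>real N powr (q / 2)\<close> comes from the norm bound on the
      right and is cancelled; it is positive because \<open>N\<close> is at least 1.\<close>
    moreover have "real N powr q = real N powr (q / 2) * real N powr (q / 2)"
      by (simp add: powr_add[symmetric])
    ultimately have "real N powr (q / 2) * real N powr (q / 2)
        \<le> (real m * K powr q * D powr q) * real N powr (q / 2)"
      using m by (simp add: field_simps)
    then show "real N powr (q / 2) \<le> real m * K powr q * D powr q"
      using N by (simp only: mult_le_cancel_right) simp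
  qed
qed

end
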